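(* Let $\gamma,\eta,\lambda\in\mathbb{R}$, $a\in\mathbb{C}$, $k\in\mathbb{Z}$, $m\in\mathbb{N}$ and $n\in\mathbb{N}_0$. Then $$\sum_{j=0}^{n}\binom{n}{j}\,\mathfrak{B}_{j}^{(k)}\;{}_{\mathfrak{B}}\mathfrak{D}_{n-j,a}^{[k,m-1]}(\gamma,\eta;\lambda)=\sum_{j=0}^{n}\binom{n}{j}\,\mathfrak{B}_{j}\;{}_{\mathfrak{B}}\mathfrak{D}_{n-j,a}^{[m-1]}(\gamma,\eta;\lambda),$$ where $\mathfrak{B}_j^{(k)}$ are the poly-Bernoulli numbers, $\mathfrak{B}_j$ the Bernoulli numbers, ${}_{\mathfrak{B}}\mathfrak{D}_{n,a}^{[k,m-1]}$ the generalized Apostol-Bernoulli poly-Daehee polynomials, and ${}_{\mathfrak{B}}\mathfrak{D}_{n,a}^{[m-1]}$ their $k=1$ case.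
   Context: $\mathbb{N}=\{1,2,\dots\}$, $\mathbb{N}_0=\mathbb{N}\cup\{0\}$. The polylogarithm is $\mathrm{Li}_k(z)=\sum_{r=1}^{\infty} z^r/r^k$. Generalized Apostol-Bernoulli poly-Daehee polynomials (GABPDP), defined by the generating function $$(1+x)^{\gamma}\,\frac{\log(1+x)}{\mathrm{Li}_k(1-e^{-x})}\,e^{\eta x}\left(\frac{x^m}{\lambda e^x-\sum_{l=0}^{m-1}\frac{x^l}{l!}}\right)^{a}=\sum_{n=0}^\infty {}_{\mathfrak{B}}\mathfrak{D}_{n,a}^{[k,m-1]}(\gamma,\eta;\lambda)\frac{x^n}{n!}.$$ Their $k=1$ case (where $\mathrm{Li}_1(1-e^{-x})=x$): $$(1+x)^{\gamma}\,\frac{\log(1+x)}{x}\,e^{\eta x}\left(\frac{x^m}{\lambda e^x-\sum_{l=0}^{m-1}\frac{x^l}{l!}}\right)^{a}=\sum_{n=0}^\infty {}_{\mathfrak{B}}\mathfrak{D}_{n,a}^{[m-1]}(\gamma,\eta;\lambda)\frac{x^n}{n!}.$$ Poly-Bernoulli numbers: $\frac{\mathrm{Li}_k(1-e^{-x})}{e^x-1}=\sum_{n=0}^\infty\mathfrak{B}_n^{(k)}\frac{x^n}{n!}$. Bernoulli numbers: $\frac{x}{e^x-1}=\sum_{n=0}^\infty\mathfrak{B}_n\frac{x^n}{n!}$. *)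

theory Defs
  imports "HOL-Complex_Analysis.Complex_Analysis"
begin

text \<open>
  All generating functions are formal power series over the complex numbers. Quotients are
  \<open>divide\<close> on \<open>complex fps\<close>, which cancels common powers of \<open>fps_X\<close>; every quotient formed below
  is exact for \<open>m \<ge> 1\<close>, i.e. the subdegree of the denominator does not exceed that of the
  numerator.
\<close>

definition egf_coeff :: "complex fps \<Rightarrow> nat \<Rightarrow> complex" where
  "egf_coeff F n = fact n * fps_nth F n"

lemma egf_coeff_expansion: "F = Abs_fps (\<lambda>n. egf_coeff F n / fact n)"
  by (simp add: fps_eq_iff egf_coeff_def)

definition polylog_fps :: "int \<Rightarrow> complex fps" where
  "polylog_fps k = Abs_fps (\<lambda>r. if r = 0 then 0 else 1 / (of_nat r powi k))"

text \<open>The series of \<open>Li\<^sub>k(1 - e\<^sup>-\<^sup>x)\<close>.\<close>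

definition polylog_exp_fps :: "int \<Rightarrow> complex fps" where
  "polylog_exp_fps k = polylog_fps k oo (1 - fps_exp (-1))"

definition poly_bernoulli :: "int \<Rightarrow> nat \<Rightarrow> complex" where
  "poly_bernoulli k = egf_coeff (polylog_exp_fps k / (fps_exp 1 - 1))"

definition bernoulli_number :: "nat \<Rightarrow> complex" where
  "bernoulli_number = egf_coeff (fps_X / (fps_exp 1 - 1))"

text \<open>
  Powers with complex exponent (principal branch). Write \<open>P \<noteq> 0\<close> as \<open>P = x\<^sup>s c (1 + w)\<close> with \<open>c \<noteq> 0\<close> and
  \<open>w\<close> without constant term, so that \<open>s\<close> is the subdegree of \<open>P\<close>. Then
  \<open>P\<^sup>a = x\<^sup>s\<^sup>a c\<^sup>a (1 + w)\<^sup>a\<close>, where \<open>(1 + w)\<^sup>a\<close> is the binomial series. This is a power series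
  exactly if \<open>s a\<close> is a natural number, in particular if \<open>s = 0\<close> or \<open>a\<close> is a natural number.
  In the remaining cases \<open>P\<^sup>a\<close> has no expansion into powers \<open>x\<^sup>n\<close> with \<open>n \<ge> 0\<close>; the value
  0 returned then is a convention.
\<close>

definition fps_cpow :: "complex fps \<Rightarrow> complex \<Rightarrow> complex fps" where
  "fps_cpow P a =
     (let s = subdegree P; U = fps_shift s P; c = fps_nth U 0 in
      if of_nat s * a \<in> \<nat>
      then fps_X ^ nat \<lfloor>Re (of_nat s * a)\<rfloor> * fps_const (c powr a) *
             (fps_binomial a oo (fps_const (inverse c) * U - 1))
      else 0)"

lemma fps_cpow_of_nat:
  assumes "P \<noteq> 0"
  shows "fps_cpow P (of_nat n) = P ^ n"
proof -
  define s where "s = subdegree P"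
  define U where "U = fps_shift s P"
  define c where "c = fps_nth U 0"
  have c: "c \<noteq> 0"
    using assms by (simp add: c_def U_def s_def)
  have P: "P = fps_X ^ s * U"
    unfolding U_def s_def by (metis subdegree_decompose mult.commute)
  have w0: "fps_nth (fps_const (inverse c) * U - 1) 0 = 0"
    using c by (simp add: c_def)
  have "fps_binomial (of_nat n) oo (fps_const (inverse c) * U - 1) =
          ((1 + fps_X) oo (fps_const (inverse c) * U - 1)) ^ n"
    by (simp add: fps_binomial_of_nat fps_compose_power[OF w0])
  also have "\<dots> = (fps_const (inverse c) * U) ^ n"
    by (simp add: fps_compose_add_distrib fps_X_fps_compose_startby0[OF w0])
  finally have 1: "fps_binomial (of_nat n) oo (fps_const (inverse c) * U - 1) =
                     (fps_const (inverse c) * U) ^ n" .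
  have e: "(of_nat s * of_nat n :: complex) = of_nat (s * n)" by simp
  have "fps_cpow P (of_nat n) =
          fps_X ^ (s * n) * fps_const (c powr of_nat n) * (fps_const (inverse c) * U) ^ n"
    unfolding fps_cpow_def Let_def s_def[symmetric] U_def[symmetric] c_def[symmetric] 1 e
    by (simp del: of_nat_mult)
  also have "\<dots> = fps_X ^ (s * n) * (fps_const c * fps_const (inverse c) * U) ^ n"
    using c by (simp add: powr_nat power_mult_distrib fps_const_power mult.assoc
        del: fps_const_mult)
  also have "\<dots> = P ^ n"
    using c by (simp add: P power_mult_distrib power_mult)
  finally show ?thesis .
qed

lemma has_fps_expansion_fps_cpow:
  assumes f: "f has_fps_expansion P" and f0: "f 0 \<notin> \<real>\<^sub>\<le>\<^sub>0"
  shows "(\<lambda>z. f z powr a) has_fps_expansion fps_cpow P a"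
proof -
  define c where "c = fps_nth P 0"
  have c: "c = f 0"
    using has_fps_expansion_imp_0_eq_fps_nth_0[OF f] by (simp add: c_def)
  have c0: "c \<noteq> 0" and cn: "c \<notin> \<real>\<^sub>\<le>\<^sub>0"
    using f0 by (auto simp: c)
  have s: "subdegree P = 0"
    using c0 by (simp add: c_def)
  have cpow: "fps_cpow P a =
      fps_const (c powr a) * (fps_binomial a oo (fps_const (inverse c) * P - 1))"
    by (simp add: fps_cpow_def Let_def s c_def)
  define g where "g = (\<lambda>z. inverse c * f z - 1)"
  have g: "g has_fps_expansion (fps_const (inverse c) * P - 1)"
    unfolding g_def by (intro fps_expansion_intros f)
  have "((\<lambda>z. (1 + z) powr a) \<circ> g) has_fps_expansion
          (fps_binomial a oo (fps_const (inverse c) * P - 1))"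
    using c0 by (intro has_fps_expansion_compose has_fps_expansion_binomial_complex g)
      (simp add: c_def)
  from has_fps_expansion_cmult_left[OF this, of "c powr a"]
  have *: "(\<lambda>z. c powr a * (inverse c * f z) powr a) has_fps_expansion fps_cpow P a"
    by (simp add: cpow g_def o_def)
  have lim: "(f \<longlongrightarrow> c) (nhds 0)"
    using has_fps_expansion_imp_continuous[OF f, of UNIV] c
    by (simp add: continuous_within tendsto_nhds_iff)
  have "((\<lambda>z. Im (Ln c) + Im (Ln (inverse c * f z))) \<longlongrightarrow>
           Im (Ln c) + Im (Ln (inverse c * c))) (nhds 0)"
    using c0 by (intro tendsto_intros lim) auto
  hence L: "((\<lambda>z. Im (Ln c) + Im (Ln (inverse c * f z))) \<longlongrightarrow> Im (Ln c)) (nhds 0)"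
    using c0 by simp
  have "-pi < Im (Ln c)" "Im (Ln c) < pi"
    using c0 cn mpi_less_Im_Ln[of c] Im_Ln_le_pi[of c] Im_Ln_eq_pi[of c]
    by (auto simp: order.order_iff_strict complex_nonpos_Reals_iff)
  hence e1: "eventually (\<lambda>z. -pi < Im (Ln c) + Im (Ln (inverse c * f z))) (nhds 0)"
    and e2: "eventually (\<lambda>z. Im (Ln c) + Im (Ln (inverse c * f z)) < pi) (nhds 0)"
    using order_tendstoD[OF L] by blast+
  have e3: "eventually (\<lambda>z. f z \<noteq> 0) (nhds 0)"
    using tendsto_imp_eventually_ne[OF lim c0] .
  have "eventually (\<lambda>z. c powr a * (inverse c * f z) powr a = f z powr a) (nhds 0)"
    using e1 e2 e3
  proof eventually_elim
    case (elim z)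
    have "Ln (c * (inverse c * f z)) = Ln c + Ln (inverse c * f z)"
      using elim c0 by (intro Ln_times_simple) auto
    moreover have "c * (inverse c * f z) = f z"
      using c0 by simp
    ultimately show ?case
      using elim c0 by (simp add: powr_def ring_distribs exp_add)
  qed
  from has_fps_expansion_cong[OF this refl] * show ?thesis
    by blast
qed

text \<open>\<open>(x\<^sup>m / (lam e\<^sup>x - \<Sum>l<m. x\<^sup>l / l!))\<^sup>a\<close>\<close>

definition apostol_bernoulli_factor :: "nat \<Rightarrow> complex \<Rightarrow> real \<Rightarrow> complex fps" where
  "apostol_bernoulli_factor m a lam =
     fps_cpow (fps_X ^ m /
       (fps_const (of_real lam) * fps_exp 1 - (\<Sum>l<m. fps_const (1 / fact l) * fps_X ^ l))) a"

text \<open>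
  \<open>gabpdp k m a \<gamma> \<eta> lam n\<close> is the polynomial with upper index \<open>[k, m-1]\<close> and lower indices
  \<open>n, a\<close>. The series \<open>fps_ln 1\<close> is \<open>log (1 + x)\<close> and \<open>fps_binomial \<gamma>\<close> is \<open>(1 + x)\<^sup>\<gamma>\<close>.
\<close>

definition gabpdp ::
    "int \<Rightarrow> nat \<Rightarrow> complex \<Rightarrow> real \<Rightarrow> real \<Rightarrow> real \<Rightarrow> nat \<Rightarrow> complex" where
  "gabpdp k m a \<gamma> \<eta> lam =
     egf_coeff (fps_binomial (of_real \<gamma>) * (fps_ln 1 / polylog_exp_fps k) *
       fps_exp (of_real \<eta>) * apostol_bernoulli_factor m a lam)"

definition gabdp ::
    "nat \<Rightarrow> complex \<Rightarrow> real \<Rightarrow> real \<Rightarrow> real \<Rightarrow> nat \<Rightarrow> complex" where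
  "gabdp m a \<gamma> \<eta> lam =
     egf_coeff (fps_binomial (of_real \<gamma>) * (fps_ln 1 / fps_X) *
       fps_exp (of_real \<eta>) * apostol_bernoulli_factor m a lam)"

lemma polylog_exp_fps_1: "polylog_exp_fps 1 = fps_X"
proof -
  have d: "fps_deriv (polylog_fps 1) * (1 - fps_X) = 1"
  proof -
    have "fps_deriv (polylog_fps 1) = Abs_fps (\<lambda>_. 1)"
      by (intro fps_ext) (simp add: polylog_fps_def del: of_nat_Suc)
    moreover have "Abs_fps (\<lambda>_. 1 :: complex) * (1 - fps_X) = 1"
      by (intro fps_ext) (simp add: right_diff_distrib)
    ultimately show ?thesis by simp
  qed
  have z: "fps_nth (1 - fps_exp (-1 :: complex)) 0 = 0" by simp
  have "(fps_deriv (polylog_fps 1) oo (1 - fps_exp (-1))) * fps_exp (-1) = 1"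
    using arg_cong[OF d, of "\<lambda>F. F oo (1 - fps_exp (-1))"]
    by (simp add: fps_compose_mult_distrib[OF z] fps_compose_sub_distrib z)
  hence "fps_deriv (polylog_exp_fps 1) = fps_deriv fps_X"
    by (simp add: polylog_exp_fps_def fps_compose_deriv[OF z] fps_const_neg[symmetric]
        del: fps_const_neg)
  moreover have "fps_nth (polylog_exp_fps 1) 0 = fps_nth fps_X 0"
    by (simp add: polylog_exp_fps_def polylog_fps_def)
  ultimately show ?thesis
    using fps_deriv_eq_iff[of "polylog_exp_fps 1" fps_X] by simp
qed

lemma gabpdp_1: "gabpdp 1 m a \<gamma> \<eta> lam = gabdp m a \<gamma> \<eta> lam"
  by (simp add: gabpdp_def gabdp_def polylog_exp_fps_1)

end

theory Submission
  imports Defs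
begin

text \<open>Multiplying exponential generating functions is binomial convolution of their
  coefficients (\<open>egf_coeff_mult\<close>), so each side is a coefficient of a product of two
  series. On the left the polylogarithm series is a numerator in one factor and a denominator in the
  other; on the right x plays this part. Both cancel, leaving log(1+x)/(e^x - 1) times the same
  remaining factors (\<open>polylog_cancel\<close>).\<close>

lemma egf_coeff_mult:
  "egf_coeff (F * G) n =
     (\<Sum>j=0..n. of_nat (n choose j) * egf_coeff F j * egf_coeff G (n - j))"
proof -
  have "fact n * (fps_nth F j * fps_nth G (n - j)) =
          of_nat (n choose j) * egf_coeff F j * egf_coeff G (n - j)" if "j \<le> n" for j
  proof -
    have "(fact n :: complex) = fact j * fact (n - j) * of_nat (n choose j)"
      using arg_cong[OF binomial_fact_lemma[OF that], of "of_nat :: nat \<Rightarrow> complex"] by simp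
    thus ?thesis
      by (simp add: egf_coeff_def)
  qed
  thus ?thesis
    by (subst egf_coeff_def) (simp add: fps_mult_nth sum_distrib_left)
qed

text \<open>Since 1 - e^(-x) = x + O(x^2) and the polylogarithm has linear coefficient 1 for every
  integer \<open>k\<close>, the composite starts with x. This makes the quotients by it
  exact.\<close>

lemma subdegree_polylog_exp_fps: "subdegree (polylog_exp_fps k) = 1"
proof (rule subdegreeI)
  show "fps_nth (polylog_exp_fps k) 1 \<noteq> 0"
    by (simp add: polylog_exp_fps_def polylog_fps_def fps_compose_nth)
  show "fps_nth (polylog_exp_fps k) i = 0" if "i < 1" for i
    using that by (simp add: polylog_exp_fps_def polylog_fps_def)
qed

lemma subdegree_fps_exp_minus_1: "subdegree (fps_exp 1 - 1 :: complex fps) = 1"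
  by (rule subdegreeI) auto

lemma subdegree_fps_ln_1: "subdegree (fps_ln 1 :: complex fps) = 1"
  by (rule subdegreeI) (auto simp: fps_ln_nth)

text \<open>Exact quotients telescope: either side multiplied by \<open>E\<close> gives
  \<open>L\<close>, and \<open>E\<close> can be cancelled.\<close>

lemma div_mult_div_swap:
  fixes L P Q E :: "'a :: algebraic_semidom"
  assumes "E dvd P" "P dvd L" "E dvd Q" "Q dvd L" "E \<noteq> 0"
  shows "(P div E) * (L div P) = (Q div E) * (L div Q)"
proof -
  have *: "E * ((R div E) * (L div R)) = L" if "E dvd R" "R dvd L" for R
    using that by (simp flip: mult.assoc)
  show ?thesis
    using *[OF assms(1,2)] *[OF assms(3,4)] \<open>E \<noteq> 0\<close> by (metis mult_left_cancel)
qed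

lemma polylog_cancel:
  "(polylog_exp_fps k / (fps_exp 1 - 1)) * (fps_ln 1 / polylog_exp_fps k) =
     (fps_X / (fps_exp 1 - 1)) * (fps_ln 1 / fps_X)"
proof -
  note s = subdegree_polylog_exp_fps[of k] subdegree_fps_exp_minus_1 subdegree_fps_ln_1
  have "polylog_exp_fps k \<noteq> 0" "fps_exp 1 - 1 \<noteq> (0 :: complex fps)" "fps_ln 1 \<noteq> (0 :: complex fps)"
    using s by force+
  thus ?thesis
    \<comment> \<open>Over a field, divisibility of nonzero power series is comparison of
      subdegrees; all four series here have subdegree 1.\<close>
    by (intro div_mult_div_swap) (simp_all only: fps_dvd_iff s fps_X_neq_zero subdegree_fps_X not_False_eq_True order.refl)
qed

theorem theorem2p4:
  fixes \<gamma> \<eta> lam :: real and a :: complex and k :: int and m n :: nat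
  assumes "m \<ge> 1"
  shows "(\<Sum>j=0..n. of_nat (n choose j) * poly_bernoulli k j * gabpdp k m a \<gamma> \<eta> lam (n - j)) =
         (\<Sum>j=0..n. of_nat (n choose j) * bernoulli_number j * gabdp m a \<gamma> \<eta> lam (n - j))"
proof -
  \<comment> \<open>\<open>R\<close> collects what the two generating functions share, so that they
    differ only in \<open>?B\<close> against \<open>?D\<close>.\<close>
  define R where "R = fps_binomial (of_real \<gamma>) * fps_exp (of_real \<eta>) *
    apostol_bernoulli_factor m a lam"
  let ?A = "polylog_exp_fps k / (fps_exp 1 - 1)" and ?B = "fps_ln 1 / polylog_exp_fps k"
  let ?C = "fps_X / (fps_exp 1 - 1) :: complex fps" and ?D = "fps_ln 1 / fps_X :: complex fps"
  have "gabpdp k m a \<gamma> \<eta> lam = egf_coeff (?B * R)" "gabdp m a \<gamma> \<eta> lam = egf_coeff (?D * R)"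
    by (simp_all add: gabpdp_def gabdp_def R_def mult_ac)
  moreover have "?A * (?B * R) = ?C * (?D * R)"
    using polylog_cancel[of k] by (simp flip: mult.assoc)
  ultimately show ?thesis
    unfolding poly_bernoulli_def bernoulli_number_def
    by (simp only: egf_coeff_mult[symmetric])
qed

end
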